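(* Let $L\in\mathbb R^{n\times d}$ be a rank $k$ matrix and let $p\ge1$. Then there is $s=O(k\log\log k)$ and a decomposition $L=UV^\top$ into an $n\times s$ matrix $U$ and an $s\times d$ matrix $V^\top$ such that (1) $\|Ue_i\|_p\le1$ for each $i\in[s]$, and (2) $\|V^\top e_j\|_2\le O(1)\,\|Le_j\|_p$ for each $j\in[d]$.
   Context: $e_i$ denotes the $i$-th standard basis vector of the appropriate dimension, so $Me_j$ is the $j$-th column of $M$. $O(\cdot)$ hides absolute constants; $\log\log k$ is read as at least $1$. *)

theory Defs
  imports Complex_Main "Jordan_Normal_Form.DL_Rank"
begin

definition lp_norm :: "real \<Rightarrow> real vec \<Rightarrow> real" where
  "lp_norm p v = (\<Sum>i<dim_vec v. \<bar>v $ i\<bar> powr p) powr (1 / p)"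

text \<open>The iterated logarithm is truncated from below at 1, so the junk values of
  \<^const>\<open>ln\<close> at arguments that are not positive (\<open>k \<le> 1\<close>) do not matter.\<close>

definition loglog :: "nat \<Rightarrow> real" where
  "loglog k = max 1 (ln (ln (real k)))"

end

theory Submission imports Defs begin

text \<open>Write \<open>L = A C\<close> with \<open>C\<close> having \<open>k\<close> rows, and let \<open>w\<^sub>j\<close> be the \<open>j\<close>-th column of \<open>C\<close> divided by
  the \<open>p\<close>-norm of \<open>L e\<^sub>j\<close>. Among all choices of \<open>2k\<close> of the \<open>w\<^sub>j\<close> (with repetition) as the columns
  of a matrix \<open>X\<close>, take one that maximizes \<open>det G\<close> for \<open>G = X X\<^sup>T\<close> (a D-optimal design). The leverage
  scores \<open>\<tau> u = u \<bullet> G\<^sup>-\<^sup>1 u\<close> of the columns of \<open>X\<close> add up to \<open>k\<close>, so some column \<open>u\<close> has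
  \<open>\<tau> u \<le> 1/2\<close>. Exchanging it for \<open>x = w\<^sub>j\<close> multiplies the determinant by at least
  \<open>(1 + \<tau> x) (1 - \<tau> u)\<close>, so maximality forces \<open>\<tau> x \<le> 1\<close>. Since \<open>x = X (X\<^sup>T G\<^sup>-\<^sup>1 x)\<close>
  and the coefficient vector \<open>X\<^sup>T G\<^sup>-\<^sup>1 x\<close> has squared norm \<open>\<tau> x\<close>, taking \<open>U = A X\<close> even gives
  \<open>s = 2k\<close> and the constant \<open>1\<close> in (2).\<close>

section \<open>Determinants under low-rank updates\<close>

text \<open>Both sides are the determinant of one block matrix, reduced in two ways by block column
  operations. Writing the update as \<open>M * Z * B\<close> keeps the identity free of inverses, so
  it holds over any integral domain and for singular \<open>M\<close>.\<close>

lemma det_add_mult_mult: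
  fixes M :: "'a :: idom mat"
  assumes M: "M \<in> carrier_mat n n" and Z: "Z \<in> carrier_mat n m" and B: "B \<in> carrier_mat m n"
  shows "det (M + M * Z * B) = det M * det (1\<^sub>m m + B * Z)"
proof -
  let ?N = "four_block_mat M (- (M * Z)) B (1\<^sub>m m)"
  \<comment> \<open>\<open>?P\<close> and \<open>?Q\<close> have determinant 1: multiplying
    \<open>?N\<close> by \<open>?P\<close> on the right clears the upper right block, multiplying by
    \<open>?Q\<close> clears the lower left one.\<close>
  let ?P = "four_block_mat (1\<^sub>m n) Z (0\<^sub>m m n) (1\<^sub>m m)"
  let ?Q = "four_block_mat (1\<^sub>m n) (0\<^sub>m n m) (- B) (1\<^sub>m m)"
  have MZ: "M * Z \<in> carrier_mat n m" "- (M * Z) \<in> carrier_mat n m" using M Z by auto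
  have N: "?N \<in> carrier_mat (n + m) (n + m)" using M by simp
  have "?N * ?P = four_block_mat M (0\<^sub>m n m) B (1\<^sub>m m + B * Z)"
  proof (subst mult_four_block_mat[OF M MZ(2) B one_carrier_mat one_carrier_mat Z zero_carrier_mat one_carrier_mat],
      intro arg_cong4[of _ _ _ _ _ _ _ _ four_block_mat])
    show "M * 1\<^sub>m n + - (M * Z) * 0\<^sub>m m n = M" using M Z by simp
    show "M * Z + - (M * Z) * 1\<^sub>m m = 0\<^sub>m n m" using M Z MZ by (intro eq_matI) auto
    show "B * 1\<^sub>m n + 1\<^sub>m m * 0\<^sub>m m n = B" using B by simp
    show "B * Z + 1\<^sub>m m * 1\<^sub>m m = 1\<^sub>m m + B * Z" using B Z by (intro eq_matI) auto
  qed
  then have "det (?N * ?P) = det M * det (1\<^sub>m m + B * Z)"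
    using det_four_block_mat_upper_right_zero[OF M refl B, of "1\<^sub>m m + B * Z"] B Z by simp
  moreover have "det (?N * ?P) = det ?N"
    using det_mult[OF N, of ?P] det_four_block_mat_lower_left_zero[OF one_carrier_mat Z refl one_carrier_mat]
    by (simp add: det_one)
  moreover have "?N * ?Q = four_block_mat (M + M * Z * B) (- (M * Z)) (0\<^sub>m m n) (1\<^sub>m m)"
  proof (subst mult_four_block_mat[OF M MZ(2) B one_carrier_mat one_carrier_mat zero_carrier_mat _ one_carrier_mat],
      use B in simp, intro arg_cong4[of _ _ _ _ _ _ _ _ four_block_mat])
    show "M * 1\<^sub>m n + - (M * Z) * - B = M + M * Z * B" using M Z B MZ by simp
    show "M * 0\<^sub>m n m + - (M * Z) * 1\<^sub>m m = - (M * Z)" using M Z by simp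
    show "B * 1\<^sub>m n + 1\<^sub>m m * - B = 0\<^sub>m m n" using B by (intro eq_matI) auto
    show "B * 0\<^sub>m n m + 1\<^sub>m m * 1\<^sub>m m = 1\<^sub>m m" using B by simp
  qed
  then have "det (?N * ?Q) = det (M + M * Z * B)"
    using det_four_block_mat_lower_left_zero[OF _ MZ(2) refl one_carrier_mat, of "M + M * Z * B"] M Z B
    by (simp add: det_one)
  moreover have "det (?N * ?Q) = det ?N"
    using det_mult[OF N, of ?Q] B
      det_four_block_mat_upper_right_zero[OF one_carrier_mat refl _ one_carrier_mat, of "- B"]
    by (simp add: det_one)
  ultimately show ?thesis by simp
qed

definition outer_prod :: "'a :: times vec \<Rightarrow> 'a vec \<Rightarrow> 'a mat" where
  "outer_prod a b = mat (dim_vec a) (dim_vec b) (\<lambda>(i, j). a $ i * b $ j)"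

lemma outer_prod_carrier [simp]:
  "a \<in> carrier_vec n \<Longrightarrow> b \<in> carrier_vec m \<Longrightarrow> outer_prod a b \<in> carrier_mat n m"
  by (auto simp: outer_prod_def)

lemma outer_prod_mult_vec:
  fixes a :: "'a :: comm_semiring_0 vec"
  assumes "v \<in> carrier_vec (dim_vec b)"
  shows "outer_prod a b *\<^sub>v v = (b \<bullet> v) \<cdot>\<^sub>v a"
  using assms by (intro eq_vecI)
    (auto simp: outer_prod_def scalar_prod_def sum_distrib_right sum_distrib_left mult_ac intro!: sum.cong)

text \<open>The matrix determinant lemma, which is the case \<open>m = 1\<close> above. The vector
  \<open>z\<close> stands for the inverse of \<open>M\<close> applied to the left factor of the
  update.\<close>

lemma det_add_outer_prod:
  fixes M :: "'a :: idom mat"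
  assumes M: "M \<in> carrier_mat n n" and z: "z \<in> carrier_vec n" and b: "b \<in> carrier_vec n"
  shows "det (M + outer_prod (M *\<^sub>v z) b) = det M * (1 + b \<bullet> z)"
proof -
  define Z where "Z = mat n 1 (\<lambda>(i, j). z $ i)"
  define B where "B = mat 1 n (\<lambda>(i, j). b $ j)"
  have Z: "Z \<in> carrier_mat n 1" and B: "B \<in> carrier_mat 1 n" by (auto simp: Z_def B_def)
  have "M * Z * B = outer_prod (M *\<^sub>v z) b"
    using M z b by (intro eq_matI) (auto simp: outer_prod_def Z_def B_def scalar_prod_def)
  moreover have "det (1\<^sub>m 1 + B * Z) = 1 + b \<bullet> z"
    using z b by (subst det_single) (auto simp: Z_def B_def scalar_prod_def)
  ultimately show ?thesis using det_add_mult_mult[OF M Z B] by simp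
qed

section \<open>Rank factorization through a column basis\<close>

text \<open>The columns of \<open>A\<close> form a maximal independent set of columns of
  \<open>L\<close>, and \<open>J\<close> locates them inside \<open>L\<close>. The facts about
  \<open>J\<close> later supply a selection of columns with nonzero determinant.\<close>

lemma exists_rank_factorization:
  fixes L :: "'a :: field mat"
  assumes L: "L \<in> carrier_mat n d" and k: "vec_space.rank n L = k"
  obtains A C J where "A \<in> carrier_mat n k" "C \<in> carrier_mat k d" "L = A * C"
    "\<And>i. i < k \<Longrightarrow> J i < d" "\<And>i. i < k \<Longrightarrow> col C (J i) = unit_vec k i"
    "\<And>i. i < k \<Longrightarrow> col L (J i) \<noteq> 0\<^sub>v n"
proof -
  interpret vec_space "TYPE('a)" n .
  define P where "P = (\<lambda>T. T \<subseteq> set (cols L) \<and> lin_indpt T)"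
  have cL: "set (cols L) \<subseteq> carrier_vec n" using L cols_dim by blast
  have "P {}" using finite_lin_indpt2[of "{}"] by (auto simp: P_def)
  then obtain S where "finite S" and max: "maximal S P"
    using maximal_exists_superset[of "set (cols L)" P "{}"] by (auto simp: P_def)
  have S: "S \<subseteq> set (cols L)" "lin_indpt S" using max by (auto simp: maximal_def P_def)
  have card: "card S = k" using rank_card_indpt[OF L max[unfolded P_def]] k by simp
  have Sc: "S \<subseteq> carrier_vec n" using S cL by auto
  obtain xs where xs: "set xs = S" "distinct xs" using finite_distinct_list[OF \<open>finite S\<close>] by blast
  have len: "length xs = k" using xs card distinct_card by fastforce
  define A where "A = mat_of_cols n xs"
  have A: "A \<in> carrier_mat n k" using len by (auto simp: A_def)
  have colsA: "cols A = xs" using Sc xs by (simp add: A_def)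
  have colA: "col A i = xs ! i" if "i < k" for i using colsA A that by (metis carrier_matD(2) cols_nth)
  \<comment> \<open>The last conjunct fixes the coefficients of basis columns as unit vectors at the
    moment of choice, so no uniqueness argument is needed afterwards.\<close>
  have "\<exists>c \<in> carrier_vec k. A *\<^sub>v c = v \<and> (\<forall>i<k. v = xs ! i \<longrightarrow> c = unit_vec k i)"
    if v: "v \<in> set (cols L)" for v
  proof (cases "v \<in> S")
    case True
    then obtain i where i: "i < k" "v = xs ! i" using xs len by (metis in_set_conv_nth)
    have "A *\<^sub>v unit_vec k i = col A i"
      using A i(1) by (intro eq_vecI) (auto simp: scalar_prod_right_unit)
    then have "A *\<^sub>v unit_vec k i = v" using colA[OF i(1)] i by simp
    moreover have "i' = i" if "i' < k" "v = xs ! i'" for i'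
      using that i xs(2) len nth_eq_iff_index_eq by metis
    ultimately show ?thesis by (intro bexI[of _ "unit_vec k i"]) auto
  next
    case False
    have "v \<in> span S"
    proof (rule ccontr)
      assume "v \<notin> span S"
      then have "lin_indpt (S \<union> {v})"
        using lin_dep_iff_in_span[OF Sc S(2) _ False] v cL by auto
      then have "P (S \<union> {v})" using S v by (auto simp: P_def)
      then show False using max False by (auto simp: maximal_def)
    qed
    then obtain a where "lincomb a S = v" using finite_in_span[OF \<open>finite S\<close> Sc] by auto
    then have "A *\<^sub>v vec k (\<lambda>i. a (col A i)) = v"
      using mat_mult_eq_lincomb[OF A, of a] colsA xs by simp
    moreover have "v \<noteq> xs ! i" if "i < k" for i using False that xs len by auto
    ultimately show ?thesis by (intro bexI[of _ "vec k (\<lambda>i. a (col A i))"]) auto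
  qed
  then obtain c where c: "\<And>v. v \<in> set (cols L) \<Longrightarrow> c v \<in> carrier_vec k \<and> A *\<^sub>v c v = v
      \<and> (\<forall>i<k. v = xs ! i \<longrightarrow> c v = unit_vec k i)" by metis
  define C where "C = mat_of_cols k (map c (cols L))"
  have C: "C \<in> carrier_mat k d" using L by (auto simp: C_def)
  have inL: "col L j \<in> set (cols L)" if "j < d" for j using that L by (auto simp: cols_def)
  have colC: "col C j = c (col L j)" if "j < d" for j
    using that L c[OF inL[OF that]] by (simp add: C_def)
  have "L = A * C"
  proof (rule mat_col_eqI)
    fix j assume "j < dim_col (A * C)"
    then have j: "j < d" using C by simp
    show "col L j = col (A * C) j"
      unfolding col_mult2[OF A C j] colC[OF j] using c[OF inL[OF j]] by metis
  qed (use L A C in auto)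
  moreover have "\<exists>j<d. col L j = xs ! i" if "i < k" for i
  proof -
    have "xs ! i \<in> set (cols L)" using that S xs len by auto
    then show ?thesis using L by (auto simp: cols_def)
  qed
  then obtain J where J: "\<And>i. i < k \<Longrightarrow> J i < d \<and> col L (J i) = xs ! i" by metis
  moreover have "col C (J i) = unit_vec k i" if "i < k" for i
    using J[OF that] colC c[OF inL] that by metis
  moreover have "col L (J i) \<noteq> 0\<^sub>v n" if "i < k" for i
  proof -
    have "xs ! i \<in> S" using that xs len by auto
    then show ?thesis using vs_zero_lin_dep[OF _ S(2)] Sc J[OF that] by auto
  qed
  ultimately show ?thesis using that[OF A C] by blast
qed

section \<open>Basic facts on p-norms\<close>

lemma lp_norm_nonneg: "0 \<le> lp_norm p v"
  by (simp add: lp_norm_def)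

lemma lp_norm_smult:
  assumes "p > 0"
  shows "lp_norm p (c \<cdot>\<^sub>v v) = \<bar>c\<bar> * lp_norm p v"
proof -
  have "(\<Sum>i<dim_vec v. \<bar>(c \<cdot>\<^sub>v v) $ i\<bar> powr p) = \<bar>c\<bar> powr p * (\<Sum>i<dim_vec v. \<bar>v $ i\<bar> powr p)"
    by (simp add: sum_distrib_left abs_mult powr_mult)
  then show ?thesis using assms by (simp add: lp_norm_def powr_mult sum_nonneg powr_powr)
qed

lemma lp_norm_eq_0D:
  assumes "lp_norm p v = 0" and "v \<in> carrier_vec n"
  shows "v = 0\<^sub>v n"
proof -
  have "(\<Sum>i<dim_vec v. \<bar>v $ i\<bar> powr p) = 0" using assms by (simp add: lp_norm_def)
  then show ?thesis using assms(2) by (intro eq_vecI) (auto simp: sum_nonneg_eq_0_iff)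
qed

lemma lp_norm_2: "lp_norm 2 v = sqrt (v \<bullet> v)"
  by (simp add: lp_norm_def scalar_prod_def powr_half_sqrt sum_nonneg power2_eq_square lessThan_atLeast0)

section \<open>Exchanging one column of a Gram matrix\<close>

text \<open>Two rank-one updates in a row: first \<open>x\<close> is added, then \<open>u\<close> is
  removed. Here \<open>H\<close> is the inverse of \<open>G\<close>, and \<open>nz\<close> allows
  the division in the second update.\<close>

lemma det_exchange:
  fixes G :: "'a :: field mat"
  assumes G: "G \<in> carrier_mat k k" and H: "H \<in> carrier_mat k k" and GH: "G * H = 1\<^sub>m k"
    and x: "x \<in> carrier_vec k" and u: "u \<in> carrier_vec k"
    and sym: "u \<bullet> (H *\<^sub>v x) = x \<bullet> (H *\<^sub>v u)"
    and nz: "1 + x \<bullet> (H *\<^sub>v x) \<noteq> 0"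
  shows "det (G + outer_prod x x - outer_prod u u) =
    det G * ((1 + x \<bullet> (H *\<^sub>v x)) * (1 - u \<bullet> (H *\<^sub>v u)) + (x \<bullet> (H *\<^sub>v u))\<^sup>2)"
proof -
  define t where "t = 1 + x \<bullet> (H *\<^sub>v x)"
  define s where "s = x \<bullet> (H *\<^sub>v u)"
  define G' where "G' = G + outer_prod x x"
  have G': "G' \<in> carrier_mat k k" using G x by (simp add: G'_def)
  have Hx: "H *\<^sub>v x \<in> carrier_vec k" and Hu: "H *\<^sub>v u \<in> carrier_vec k" using H x u by auto
  have GHv: "G *\<^sub>v (H *\<^sub>v v) = v" if "v \<in> carrier_vec k" for v
    using assoc_mult_mat_vec[OF G H that] GH that by simp
  have G'H: "G' *\<^sub>v (H *\<^sub>v v) = v + (x \<bullet> (H *\<^sub>v v)) \<cdot>\<^sub>v x" if v: "v \<in> carrier_vec k" for v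
    unfolding G'_def using add_mult_distrib_mat_vec[OF G outer_prod_carrier[OF x x], of "H *\<^sub>v v"] H v x
    by (simp add: GHv outer_prod_mult_vec)
  have detG': "det G' = det G * t"
    using det_add_outer_prod[OF G Hx x] by (simp add: GHv[OF x] G'_def t_def)
  \<comment> \<open>By the Sherman-Morrison formula this is the solution of
    \<open>G' *\<^sub>v z = - u\<close>.\<close>
  define z where "z = (s / t) \<cdot>\<^sub>v (H *\<^sub>v x) + (- 1) \<cdot>\<^sub>v (H *\<^sub>v u)"
  have z: "z \<in> carrier_vec k" using Hx Hu by (simp add: z_def)
  have "G' *\<^sub>v z = (s / t) \<cdot>\<^sub>v (x + (x \<bullet> (H *\<^sub>v x)) \<cdot>\<^sub>v x) + (- 1) \<cdot>\<^sub>v (u + s \<cdot>\<^sub>v x)"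
    unfolding z_def using Hx Hu G'
    by (simp add: mult_add_distrib_mat_vec[OF G'] mult_mat_vec[OF G'] G'H x u s_def)
  also have "\<dots> = - u"
  proof (intro eq_vecI)
    fix i assume "i < dim_vec (- u)"
    then have "i < k" using u by simp
    then have "((s / t) \<cdot>\<^sub>v (x + (x \<bullet> (H *\<^sub>v x)) \<cdot>\<^sub>v x) + (- 1) \<cdot>\<^sub>v (u + s \<cdot>\<^sub>v x)) $ i
      = (s / t) * (x $ i + (t - 1) * x $ i) - (u $ i + s * x $ i)"
      using x u by (simp add: t_def)
    also have "\<dots> = - u $ i" using nz by (simp add: field_simps flip: t_def)
    finally show "((s / t) \<cdot>\<^sub>v (x + (x \<bullet> (H *\<^sub>v x)) \<cdot>\<^sub>v x) + (- 1) \<cdot>\<^sub>v (u + s \<cdot>\<^sub>v x)) $ i = (- u) $ i"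
      using \<open>i < k\<close> u by simp
  qed (use x u in auto)
  finally have "det (G' + outer_prod (- u) u) = det G' * (1 + u \<bullet> z)"
    using det_add_outer_prod[OF G' z u] by simp
  moreover have "u \<bullet> z = (s / t) * s - u \<bullet> (H *\<^sub>v u)"
    unfolding z_def using u Hx Hu sym by (simp add: scalar_prod_add_distrib[OF u] s_def)
  moreover have "G' + outer_prod (- u) u = G + outer_prod x x - outer_prod u u"
    using G x u by (intro eq_matI) (auto simp: G'_def outer_prod_def)
  ultimately show ?thesis using nz
    by (simp add: detG' field_simps power2_eq_square flip: t_def s_def)
qed

lemma mult_transpose_mult_vec:
  fixes X :: "'a :: comm_semiring_0 mat"
  assumes X: "X \<in> carrier_mat k s" and H: "H \<in> carrier_mat k m" and v: "v \<in> carrier_vec m"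
  shows "(X * X\<^sup>T * H) *\<^sub>v v = X *\<^sub>v (X\<^sup>T *\<^sub>v (H *\<^sub>v v))"
proof -
  have "(X * X\<^sup>T * H) *\<^sub>v v = (X * X\<^sup>T) *\<^sub>v (H *\<^sub>v v)"
    using X H v by (intro assoc_mult_mat_vec[of _ k k _ m]) auto
  also have "\<dots> = X *\<^sub>v (X\<^sup>T *\<^sub>v (H *\<^sub>v v))"
    using X H v by (intro assoc_mult_mat_vec[of _ k s _ k]) auto
  finally show ?thesis .
qed

lemma col_mult_mult:
  fixes A :: "'a :: comm_semiring_0 mat"
  assumes A: "A \<in> carrier_mat n k" and B: "B \<in> carrier_mat k m" and C: "C \<in> carrier_mat m d"
    and j: "j < d"
  shows "col (A * B * C) j = A *\<^sub>v (B *\<^sub>v col C j)"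
proof -
  have "col (A * B * C) j = (A * B) *\<^sub>v col C j"
    using A B C j by (intro col_mult2[of _ n m _ d]) auto
  also have "\<dots> = A *\<^sub>v (B *\<^sub>v col C j)"
    using A B C j by (intro assoc_mult_mat_vec[of _ n k _ m]) (auto intro!: carrier_vecI)
  finally show ?thesis .
qed

section \<open>The D-optimal selection\<close>

text \<open>Multiples of all unit vectors occur among the columns of \<open>W\<close>, so some
  selection has positive determinant and a maximizer has an invertible Gram matrix. The last
  conclusion bounds the leverage scores.\<close>

lemma exists_D_optimal_selection:
  fixes W :: "real mat"
  assumes W: "W \<in> carrier_mat k d"
    and J: "\<And>i. i < k \<Longrightarrow> J i < d"
    and WJ: "\<And>i. i < k \<Longrightarrow> col W (J i) = b i \<cdot>\<^sub>v unit_vec k i"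
    and b: "\<And>i. i < k \<Longrightarrow> b i \<noteq> 0"
  obtains X H where "X \<in> carrier_mat k (2 * k)" "H \<in> carrier_mat k k" "X * X\<^sup>T * H = 1\<^sub>m k"
    "\<And>i. i < 2 * k \<Longrightarrow> \<exists>j<d. col X i = col W j"
    "\<And>j. j < d \<Longrightarrow> col (X\<^sup>T * H * W) j \<bullet> col (X\<^sup>T * H * W) j \<le> 1"
proof -
  define X where "X = (\<lambda>f. mat k (2 * k) (\<lambda>(r, i). W $$ (r, f i)))"
  define G where "G = (\<lambda>f :: nat \<Rightarrow> nat. X f * (X f)\<^sup>T)"
  define F where "F = PiE {..<2 * k} (\<lambda>_. {..<d})"
  have X: "X f \<in> carrier_mat k (2 * k)" and G: "G f \<in> carrier_mat k k" for f
    by (auto simp: X_def G_def)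
  have G_entry: "G f $$ (r, c) = (\<Sum>i<2 * k. W $$ (r, f i) * W $$ (c, f i))" if "r < k" "c < k" for f r c
    using that by (simp add: G_def X_def scalar_prod_def lessThan_atLeast0)
  \<comment> \<open>Each index \<open>J r\<close> is chosen twice, which makes \<open>G f0\<close>
    diagonal with positive diagonal entries.\<close>
  define f0 where "f0 = restrict (\<lambda>i. J (i mod k)) {..<2 * k}"
  have f0: "f0 \<in> F" using J by (auto simp: f0_def F_def)
  have W0: "W $$ (r, f0 i) = (if r = i mod k then b r else 0)" if "r < k" "i < 2 * k" for r i
  proof -
    have m: "i mod k < k" using that by simp
    have "W $$ (r, f0 i) = col W (J (i mod k)) $ r" using that W J[OF m] by (simp add: f0_def)
    also have "\<dots> = (if r = i mod k then b r else 0)" using that m by (simp add: WJ)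
    finally show ?thesis .
  qed
  have "det (G f0) > 0"
  proof -
    have "upper_triangular (G f0)"
      using G[of f0] by (auto simp: upper_triangular_def G_entry W0 intro!: sum.neutral)
    then have "det (G f0) = prod_list (diag_mat (G f0))" by (rule det_upper_triangular[OF _ G])
    also have "\<dots> = (\<Prod>r<k. G f0 $$ (r, r))" using G[of f0] by (simp add: prod_list_diag_prod lessThan_atLeast0)
    also have "\<dots> > 0"
    proof (intro prod_pos ballI)
      fix r assume r: "r \<in> {..<k}"
      have "0 < b r * b r" using b r by (auto simp: zero_less_mult_iff linorder_neq_iff)
      also have "\<dots> = W $$ (r, f0 r) * W $$ (r, f0 r)" using r by (simp add: W0)
      also have "\<dots> \<le> (\<Sum>i<2 * k. W $$ (r, f0 i) * W $$ (r, f0 i))"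
        using r by (intro member_le_sum) auto
      finally show "0 < G f0 $$ (r, r)" using r by (simp add: G_entry)
    qed
    finally show ?thesis .
  qed
  have "finite F" by (simp add: F_def finite_PiE)
  then have "Max ((\<lambda>g. det (G g)) ` F) \<in> (\<lambda>g. det (G g)) ` F" using f0 by (intro Max_in) auto
  then obtain f where f: "f \<in> F" and f_Max: "Max ((\<lambda>g. det (G g)) ` F) = det (G f)" by blast
  have max: "det (G g) \<le> det (G f)" if "g \<in> F" for g
    unfolding f_Max[symmetric] using that \<open>finite F\<close> by (intro Max_ge) auto
  have pos: "det (G f) > 0" using \<open>det (G f0) > 0\<close> max[OF f0] by simp
  then obtain H where H: "H \<in> carrier_mat k k" and GH: "G f * H = 1\<^sub>m k"
    using det_non_zero_imp_unit[OF G, of f "()"] by (auto simp: Units_def ring_mat_def)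
  have HG: "H * G f = 1\<^sub>m k" by (rule mat_mult_left_right_inverse[OF G H GH])
  \<comment> \<open>\<open>q v\<close> is a coefficient vector representing \<open>v\<close> by the
    columns of \<open>X f\<close>. Its inner products, computed in \<open>qq\<close>, are those of
    the form given by \<open>H\<close>.\<close>
  define q where "q = (\<lambda>v. (X f)\<^sup>T *\<^sub>v (H *\<^sub>v v))"
  have q: "q v \<in> carrier_vec (2 * k)" for v
    using X[of f] by (auto simp: q_def intro!: carrier_vecI)
  have qq: "q v \<bullet> q w = w \<bullet> (H *\<^sub>v v)" if "v \<in> carrier_vec k" "w \<in> carrier_vec k" for v w
  proof -
    have "q v \<bullet> q w = ((X f)\<^sup>T *\<^sub>v (H *\<^sub>v v)) \<bullet> q w" by (simp add: q_def)
    also have "\<dots> = (H *\<^sub>v v) \<bullet> (X f *\<^sub>v q w)"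
      using transpose_vec_mult_scalar[OF X q] H that by simp
    also have "X f *\<^sub>v q w = (G f * H) *\<^sub>v w"
      using mult_transpose_mult_vec[OF X H, of w] that by (simp add: q_def G_def)
    also have "\<dots> = w" using that by (simp add: GH)
    also have "(H *\<^sub>v v) \<bullet> w = w \<bullet> (H *\<^sub>v v)" using that H by (intro comm_scalar_prod) auto
    finally show ?thesis .
  qed
  have le1: "q x \<bullet> q x \<le> 1" if j: "j < d" and x_def: "x = col W j" for j x
  \<comment> \<open>For \<open>k = 0\<close> there is no column to exchange, and \<open>q x\<close>
    has dimension 0.\<close>
  proof (cases "k = 0")
    case True
    then show ?thesis using q[of x] by (simp add: scalar_prod_def)
  next
    case False
    have x: "x \<in> carrier_vec k" using W by (auto simp: x_def intro!: carrier_vecI)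
    define u where "u = (\<lambda>i. col W (f i))"
    have u: "u i \<in> carrier_vec k" for i using W by (auto simp: u_def intro!: carrier_vecI)
    have fd: "f i < d" if "i < 2 * k" for i using f that by (auto simp: F_def)
    have "q (u i) \<bullet> q (u i) = (\<Sum>r<k. (H * X f) $$ (r, i) * X f $$ (r, i))" if i: "i < 2 * k" for i
    proof -
      have colX: "col (X f) i = u i"
        using i fd[OF i] W by (intro eq_vecI) (auto simp: X_def u_def)
      have "q (u i) \<bullet> q (u i) = (H *\<^sub>v u i) \<bullet> u i"
        using qq[OF u u] u H comm_scalar_prod[of "u i" k "H *\<^sub>v u i"] by simp
      also have "\<dots> = (\<Sum>r<k. (H *\<^sub>v u i) $ r * u i $ r)"
        using u[of i] by (simp add: scalar_prod_def lessThan_atLeast0)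
      also have "\<dots> = (\<Sum>r<k. (H * X f) $$ (r, i) * X f $$ (r, i))"
        using i X[of f] H by (intro sum.cong) (auto simp flip: colX)
      finally show ?thesis .
    qed
    then have "(\<Sum>i<2 * k. q (u i) \<bullet> q (u i)) = (\<Sum>i<2 * k. \<Sum>r<k. (H * X f) $$ (r, i) * X f $$ (r, i))"
      by simp
    \<comment> \<open>The scores sum to the trace of \<open>H * G f\<close>, the identity of size
      \<open>k\<close>. There are \<open>2 * k\<close> of them, so their average is 1/2.\<close>
    also have "\<dots> = (\<Sum>r<k. (H * X f * (X f)\<^sup>T) $$ (r, r))"
      using X[of f] H by (subst sum.swap) (simp add: scalar_prod_def lessThan_atLeast0 del: assoc_mult_mat)
    also have "H * X f * (X f)\<^sup>T = 1\<^sub>m k" using HG X[of f] H by (simp add: G_def)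
    finally have tr: "(\<Sum>i<2 * k. q (u i) \<bullet> q (u i)) = k" by simp
    have "\<exists>i<2 * k. q (u i) \<bullet> q (u i) \<le> 1 / 2"
    proof (rule ccontr)
      assume "\<not> ?thesis"
      then have "(\<Sum>i<2 * k. (1 / 2 :: real)) < (\<Sum>i<2 * k. q (u i) \<bullet> q (u i))"
        using False by (intro sum_strict_mono) (auto simp: not_le lessThan_empty_iff)
      then show False using tr by simp
    qed
    then obtain i where i: "i < 2 * k" and qi: "q (u i) \<bullet> q (u i) \<le> 1 / 2" by blast
    have nn: "0 \<le> q x \<bullet> q x" by (simp add: scalar_prod_def sum_nonneg)
    have "f(i := j) \<in> F"
      using PiE_fun_upd[of j "\<lambda>_. {..<d}" i f "{..<2 * k}"] f i j by (simp add: F_def insert_absorb)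
    moreover have "G (f(i := j)) = G f + outer_prod x x - outer_prod (u i) (u i)"
    proof (rule eq_matI, goal_cases)
      case (1 r c)
      then have rc: "r < k" "c < k" using u[of i] by (auto simp: outer_prod_def)
      have "G g $$ (r, c) = W $$ (r, g i) * W $$ (c, g i)
          + (\<Sum>l\<in>{..<2 * k} - {i}. W $$ (r, g l) * W $$ (c, g l))" for g
        using i by (simp add: G_entry rc sum.remove)
      from this[of "f(i := j)"] this[of f] show ?case
        using rc x u[of i] W G[of f] fd[OF i] j by (simp add: outer_prod_def x_def u_def)
    qed (use G[of "f(i := j)"] u[of i] in \<open>auto simp: outer_prod_def\<close>)
    \<comment> \<open>Symmetry of \<open>H\<close> on these vectors comes from reading
      \<open>qq\<close> in both orders.\<close>
    moreover have "u i \<bullet> (H *\<^sub>v x) = x \<bullet> (H *\<^sub>v u i)"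
      using qq[OF x u] qq[OF u x] comm_scalar_prod[OF q q] by metis
    ultimately have "det (G f) * ((1 + q x \<bullet> q x) * (1 - q (u i) \<bullet> q (u i)) + (x \<bullet> (H *\<^sub>v u i))\<^sup>2)
        \<le> det (G f)"
      using max[of "f(i := j)"] det_exchange[OF G H GH x u, of i] nn by (simp add: qq[OF x x] qq[OF u u])
    then have exch: "(1 + q x \<bullet> q x) * (1 - q (u i) \<bullet> q (u i)) + (x \<bullet> (H *\<^sub>v u i))\<^sup>2 \<le> 1"
      using pos by simp
    \<comment> \<open>Dropping the square from \<open>exch\<close> leaves half of
      \<open>1 + q x \<bullet> q x\<close> bounded by 1, which is the claim.\<close>
    have "(1 + q x \<bullet> q x) * (1 / 2) \<le> (1 + q x \<bullet> q x) * (1 - q (u i) \<bullet> q (u i))"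
      using nn qi by (intro mult_left_mono) auto
    also have "\<dots> \<le> (1 + q x \<bullet> q x) * (1 - q (u i) \<bullet> q (u i)) + (x \<bullet> (H *\<^sub>v u i))\<^sup>2" by simp
    also note exch
    finally show ?thesis by simp
  qed
  have "\<exists>j<d. col (X f) i = col W j" if "i < 2 * k" for i
    using that f W by (intro exI[of _ "f i"]) (auto simp: X_def F_def PiE_iff intro!: eq_vecI)
  moreover have "col ((X f)\<^sup>T * H * W) j = q (col W j)" if "j < d" for j
    using col_mult_mult[OF _ H W that, of "(X f)\<^sup>T"] X[of f] by (simp add: q_def)
  ultimately show ?thesis using that[OF X H] GH le1 by (simp add: G_def)
qed

section \<open>The well-conditioned factorization\<close>

text \<open>The selection is applied to the normalized columns, and the normalization is then undone
  in \<open>V\<close>. The \<open>p\<close>-norm enters through homogeneity and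
  definiteness.\<close>

lemma exists_well_conditioned_factorization:
  assumes L: "L \<in> carrier_mat n d" and rank: "vec_space.rank n L = k" and p: "1 \<le> p"
  obtains U V where "U \<in> carrier_mat n (2 * k)" "V \<in> carrier_mat d (2 * k)" "L = U * V\<^sup>T"
    "\<And>i. i < 2 * k \<Longrightarrow> lp_norm p (col U i) \<le> 1"
    "\<And>j. j < d \<Longrightarrow> lp_norm 2 (col V\<^sup>T j) \<le> lp_norm p (col L j)"
proof -
  obtain A C J where A: "A \<in> carrier_mat n k" and C: "C \<in> carrier_mat k d" and LAC: "L = A * C"
    and J: "\<And>i. i < k \<Longrightarrow> J i < d" "\<And>i. i < k \<Longrightarrow> col C (J i) = unit_vec k i"
    "\<And>i. i < k \<Longrightarrow> col L (J i) \<noteq> 0\<^sub>v n"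
    using exists_rank_factorization[OF L rank] by blast
  define a where "a = (\<lambda>j. lp_norm p (col L j))"
  \<comment> \<open>If \<open>a j = 0\<close>, then \<open>1 / a j = 0\<close> makes column \<open>j\<close> of \<open>W\<close> vanish; then \<open>L e\<^sub>j = 0\<close> as well,
    so \<open>L = A W diag(a)\<close> holds in all columns.\<close>
  define W where "W = mat k d (\<lambda>(r, j). (1 / a j) * C $$ (r, j))"
  have W: "W \<in> carrier_mat k d" by (simp add: W_def)
  have colW: "col W j = (1 / a j) \<cdot>\<^sub>v col C j" if "j < d" for j
    using that C by (intro eq_vecI) (auto simp: W_def)
  have a0: "col L j = 0\<^sub>v n" if "a j = 0" for j
    using that L by (intro lp_norm_eq_0D[of p]) (auto simp: a_def)
  have AW: "A *\<^sub>v col W j = (1 / a j) \<cdot>\<^sub>v col L j" if "j < d" for j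
  proof -
    have "A *\<^sub>v col W j = (1 / a j) \<cdot>\<^sub>v (A *\<^sub>v col C j)"
      unfolding colW[OF that] using C by (intro mult_mat_vec[OF A] carrier_vecI) simp
    then show ?thesis unfolding LAC col_mult2[OF A C that] .
  qed
  have WJ: "col W (J i) = (1 / a (J i)) \<cdot>\<^sub>v unit_vec k i" "1 / a (J i) \<noteq> 0" if "i < k" for i
    using that J a0 colW by auto
  obtain X H where X: "X \<in> carrier_mat k (2 * k)" and H: "H \<in> carrier_mat k k"
    and XH: "X * X\<^sup>T * H = 1\<^sub>m k" and colX: "\<And>i. i < 2 * k \<Longrightarrow> \<exists>j<d. col X i = col W j"
    and le1: "\<And>j. j < d \<Longrightarrow> col (X\<^sup>T * H * W) j \<bullet> col (X\<^sup>T * H * W) j \<le> 1"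
    by (rule exists_D_optimal_selection[OF W J(1) WJ]) (assumption | rule that)+
  define Z where "Z = X\<^sup>T * H * W"
  have Z: "Z \<in> carrier_mat (2 * k) d" using X H W by (auto simp: Z_def)
  define V where "V = mat d (2 * k) (\<lambda>(j, i). a j * Z $$ (i, j))"
  have colV: "col V\<^sup>T j = a j \<cdot>\<^sub>v col Z j" if "j < d" for j
    using that Z by (intro eq_vecI) (auto simp: V_def)
  have V: "V \<in> carrier_mat d (2 * k)" "V\<^sup>T \<in> carrier_mat (2 * k) d" by (auto simp: V_def)
  have U: "A * X \<in> carrier_mat n (2 * k)" using A X by simp
  have "L = A * X * V\<^sup>T"
  proof (rule mat_col_eqI)
    fix j assume "j < dim_col (A * X * V\<^sup>T)"
    then have j: "j < d" using V by simp
    have wj: "col W j \<in> carrier_vec k" using W by (intro carrier_vecI) simp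
    \<comment> \<open>Since \<open>X * X\<^sup>T * H\<close> is the identity, column
      \<open>j\<close> of \<open>Z\<close> holds coefficients of \<open>col W j\<close> in the
      columns of \<open>X\<close>.\<close>
    have "X *\<^sub>v col Z j = (X * X\<^sup>T * H) *\<^sub>v col W j"
      unfolding mult_transpose_mult_vec[OF X H wj] Z_def
      using col_mult_mult[OF _ H W j, of "X\<^sup>T"] X by simp
    then have XZ: "X *\<^sub>v col Z j = col W j" using wj by (simp add: XH)
    have zj: "col Z j \<in> carrier_vec (2 * k)" using Z by (intro carrier_vecI) simp
    have "col (A * X * V\<^sup>T) j = A *\<^sub>v (X *\<^sub>v (a j \<cdot>\<^sub>v col Z j))"
      using j A X zj by (simp add: col_mult2[OF U V(2)] colV)
    also have "\<dots> = a j \<cdot>\<^sub>v ((1 / a j) \<cdot>\<^sub>v col L j)"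
      using zj wj j by (simp add: mult_mat_vec[OF X] mult_mat_vec[OF A] XZ AW)
    also have "\<dots> = col L j" using a0[of j] by (cases "a j = 0") (auto simp: smult_smult_assoc)
    finally show "col L j = col (A * X * V\<^sup>T) j" by simp
  qed (use L A V in auto)
  moreover have "lp_norm p (col (A * X) i) \<le> 1" if i: "i < 2 * k" for i
  proof -
    obtain j where j: "j < d" "col X i = col W j" using colX[OF i] by blast
    then have "col (A * X) i = (1 / a j) \<cdot>\<^sub>v col L j" using col_mult2[OF A X i] AW by simp
    \<comment> \<open>The norm is \<open>a j / a j\<close>, which is 1, or 0 when
      \<open>a j = 0\<close> because division by zero yields 0.\<close>
    then show ?thesis using p lp_norm_nonneg[of p "col L j"] by (simp add: lp_norm_smult a_def)
  qed
  moreover have "lp_norm 2 (col V\<^sup>T j) \<le> lp_norm p (col L j)" if j: "j < d" for j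
  proof -
    have "a j \<ge> 0" by (simp add: a_def lp_norm_nonneg)
    moreover have "lp_norm 2 (col Z j) \<le> 1" using le1[OF j] by (simp add: lp_norm_2 flip: Z_def)
    ultimately have "lp_norm 2 (col V\<^sup>T j) \<le> a j"
      using j by (simp add: colV lp_norm_smult mult_left_le)
    then show ?thesis by (simp add: a_def)
  qed
  ultimately show ?thesis using that[OF U V(1)] by blast
qed

theorem theorem1p13:
  "\<exists>C1 > (0::real). \<exists>C2 > (0::real).
     \<forall>(n::nat) (d::nat) (k::nat) (L::real mat) (p::real).
       L \<in> carrier_mat n d \<longrightarrow> vec_space.rank n L = k \<longrightarrow> 1 \<le> p \<longrightarrow>
       (\<exists>(s::nat) (U::real mat) (V::real mat).
          real s \<le> C1 * (real k * loglog k) \<and>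
          U \<in> carrier_mat n s \<and> V \<in> carrier_mat d s \<and>
          L = U * V\<^sup>T \<and>
          (\<forall>i<s. lp_norm p (col U i) \<le> 1) \<and>
          (\<forall>j<d. lp_norm 2 (col (V\<^sup>T) j) \<le> C2 * lp_norm p (col L j)))"
proof -
  \<comment> \<open>The truncation gives \<open>loglog k \<ge> 1\<close>, so the linear size
    \<open>2 * k\<close> fits the bound with \<open>C1 = 2\<close>, and
    \<open>C2 = 1\<close>.\<close>
  have "real (2 * k) \<le> 2 * (real k * loglog k)" for k
    using mult_left_mono[of 1 "loglog k" "real k"] by (simp add: loglog_def)
  then have "\<exists>s U V. real s \<le> 2 * (real k * loglog k) \<and> U \<in> carrier_mat n s \<and> V \<in> carrier_mat d s \<and>
      L = U * V\<^sup>T \<and> (\<forall>i<s. lp_norm p (col U i) \<le> 1) \<and>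
      (\<forall>j<d. lp_norm 2 (col V\<^sup>T j) \<le> 1 * lp_norm p (col L j))"
    if L: "L \<in> carrier_mat n d" and rank: "vec_space.rank n L = k" and p: "1 \<le> p" for n d k L p
    using exists_well_conditioned_factorization[OF L rank p] by (metis mult_1)
  then show ?thesis
    by (intro exI[where x = "2::real"] conjI exI[where x = "1::real"] allI impI) simp_all
qed

end
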